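(* Let $g, r, d$ be integers with $g \ge 0$ and $r \ge 0$, and set $\rho = g-(r+1)(g-d+r)$. Let $\Gamma$ be a chain of $g$ loops with generic edge lengths. (1) If $\rho<0$, then $\Gamma$ has no effective divisors of degree $d$ and rank at least $r$. (2) If $\rho\ge 0$, then $\Gamma$ has no effective divisors $D$ of degree $d$ and rank at least $r$ that contain $(r+\rho+1)\,v_0$, i.e. such that $D-(r+\rho+1)v_0$ is effective.
   Context: Chain of loops: for $g\ge 0$ and positive reals $\ell_1,\dots,\ell_g,m_1,\dots,m_g$, the chain of $g$ loops $\Gamma$ is the compact connected metric graph with points $v_0,\dots,v_g$ in which, for each $1\le i\le g$, exactly two edges join $v_{i-1}$ to $v_i$: a top edge of length $\ell_i$ and a bottom edge of length $m_i$ (together forming the $i$th loop); there are no other edges (for $g=0$, $\Gamma$ is the single point $v_0$). Its genus (first Betti number) is $g$. The edge lengths are generic if none of the ratios $\ell_i/m_i$ is equal to the ratio of two positive integers whose sum is less than or equal to $2g-2$. Divisors on a metric graph $\Gamma$: $\operatorname{Div}(\Gamma)$ is the free abelian group on the points of $\Gamma$; the degree of a divisor is the sum of its coefficients; a divisor is effective if all its coefficients are nonnegative. For a continuous function $\psi$ on $\Gamma$ that is linear with integer slope on each edge of some finite subdivision of $\Gamma$, $\operatorname{div}(\psi)=\sum_v \operatorname{ord}_v(\psi)\,v$, where $\operatorname{ord}_v(\psi)$ is the sum of the incoming slopes of $\psi$ at $v$ along the edges containing $v$. Two divisors are equivalent, $D\sim D'$, if $D-D'=\operatorname{div}(\psi)$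 for some such $\psi$. Rank: $r(D)=-1$ if $D$ is not equivalent to an effective divisor; otherwise $r(D)$ is the largest nonnegative integer $r$ such that $D-E$ is equivalent to an effective divisor for every effective divisor $E$ of degree $r$ on $\Gamma$. *)

theory Defs
  imports
    "HOL-Analysis.Analysis"
    "HOL-Algebra.Free_Abelian_Groups"
begin

section \<open>Metric graphs\<close>

text \<open>
  A metric graph is given by a model: a finite multigraph with positive edge lengths.  The
  orientation of an edge only fixes its parametrization by \<open>{0..edge_len \<Gamma> e}\<close>, running from
  tail to head.
\<close>

record ('v, 'e) metric_graph =
  verts :: "'v set"
  edges :: "'e set"
  tail :: "'e \<Rightarrow> 'v"
  head :: "'e \<Rightarrow> 'v"
  edge_len :: "'e \<Rightarrow> real"

datatype ('v, 'e) point = Vertex 'v | Interior 'e real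

definition points :: "('v, 'e) metric_graph \<Rightarrow> ('v, 'e) point set" where
  "points \<Gamma> = Vertex ` verts \<Gamma> \<union> {Interior e t | e t. e \<in> edges \<Gamma> \<and> 0 < t \<and> t < edge_len \<Gamma> e}"

definition edge_point :: "('v, 'e) metric_graph \<Rightarrow> 'e \<Rightarrow> real \<Rightarrow> ('v, 'e) point" where
  "edge_point \<Gamma> e t =
     (if t = 0 then Vertex (tail \<Gamma> e)
      else if t = edge_len \<Gamma> e then Vertex (head \<Gamma> e)
      else Interior e t)"

text \<open>
  The topology glueing the intervals \<open>{0..edge_len \<Gamma> e}\<close> along their end points, i.e. the final
  topology for the parametrizations of the edges.
\<close>

definition graph_open :: "('v, 'e) metric_graph \<Rightarrow> ('v, 'e) point set \<Rightarrow> bool" where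
  "graph_open \<Gamma> U \<longleftrightarrow> U \<subseteq> points \<Gamma> \<and>
     (\<forall>e\<in>edges \<Gamma>. openin (top_of_set {0..edge_len \<Gamma> e})
                   {t \<in> {0..edge_len \<Gamma> e}. edge_point \<Gamma> e t \<in> U})"

definition graph_topology :: "('v, 'e) metric_graph \<Rightarrow> ('v, 'e) point topology" where
  "graph_topology \<Gamma> = topology (graph_open \<Gamma>)"

lemma istopology_graph_open: "istopology (graph_open \<Gamma>)"
  unfolding istopology_def
proof (intro conjI allI impI)
  fix S T assume S: "graph_open \<Gamma> S" and T: "graph_open \<Gamma> T"
  have "{t \<in> {0..edge_len \<Gamma> e}. edge_point \<Gamma> e t \<in> S \<inter> T} =
      {t \<in> {0..edge_len \<Gamma> e}. edge_point \<Gamma> e t \<in> S} \<inter>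
      {t \<in> {0..edge_len \<Gamma> e}. edge_point \<Gamma> e t \<in> T}" for e
    by auto
  with S T show "graph_open \<Gamma> (S \<inter> T)"
    unfolding graph_open_def by (metis (no_types, lifting) le_infI1 openin_Int)
next
  fix \<K> assume K: "\<forall>K\<in>\<K>. graph_open \<Gamma> K"
  have eq: "{t \<in> {0..edge_len \<Gamma> e}. edge_point \<Gamma> e t \<in> \<Union>\<K>} =
      (\<Union>K\<in>\<K>. {t \<in> {0..edge_len \<Gamma> e}. edge_point \<Gamma> e t \<in> K})" for e
    by auto
  show "graph_open \<Gamma> (\<Union>\<K>)"
    unfolding graph_open_def eq
    by (intro conjI ballI openin_Union) (use K in \<open>auto simp: graph_open_def\<close>)
qed

lemma openin_graph_topology: "openin (graph_topology \<Gamma>) U \<longleftrightarrow> graph_open \<Gamma> U"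
  unfolding graph_topology_def using istopology_graph_open topology_inverse' by metis


section \<open>Divisors of piecewise linear functions\<close>

text \<open>
  The finite subdivision of an edge is given by the set \<open>S\<close> of its break points.
\<close>

definition PL :: "('v, 'e) metric_graph \<Rightarrow> (('v, 'e) point \<Rightarrow> real) \<Rightarrow> bool" where
  "PL \<Gamma> \<psi> \<longleftrightarrow> continuous_map (graph_topology \<Gamma>) euclideanreal \<psi> \<and>
     (\<forall>e\<in>edges \<Gamma>. \<exists>S. finite S \<and> {0, edge_len \<Gamma> e} \<subseteq> S \<and> S \<subseteq> {0..edge_len \<Gamma> e} \<and>
        (\<forall>a\<in>S. \<forall>b\<in>S. a < b \<and> S \<inter> {a<..<b} = {} \<longrightarrow>
           (\<exists>(k::int) c. \<forall>t\<in>{a..b}. \<psi> (edge_point \<Gamma> e t) = c + of_int k * t)))"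

text \<open>
  Slopes of \<open>\<psi>\<close> along the edge \<open>e\<close> into the point with parameter \<open>t\<close>: arriving from the side of the
  tail (smaller parameters), respectively from the side of the head (larger parameters).
\<close>

definition slope_from_tail ::
    "('v, 'e) metric_graph \<Rightarrow> (('v, 'e) point \<Rightarrow> real) \<Rightarrow> 'e \<Rightarrow> real \<Rightarrow> int" where
  "slope_from_tail \<Gamma> \<psi> e t =
     (THE k. \<forall>\<^sub>F u in at_left t.
        \<psi> (edge_point \<Gamma> e t) = \<psi> (edge_point \<Gamma> e u) + of_int k * (t - u))"

definition slope_from_head ::
    "('v, 'e) metric_graph \<Rightarrow> (('v, 'e) point \<Rightarrow> real) \<Rightarrow> 'e \<Rightarrow> real \<Rightarrow> int" where
  "slope_from_head \<Gamma> \<psi> e t =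
     (THE k. \<forall>\<^sub>F u in at_right t.
        \<psi> (edge_point \<Gamma> e t) = \<psi> (edge_point \<Gamma> e u) + of_int k * (u - t))"

fun ord_at :: "('v, 'e) metric_graph \<Rightarrow> (('v, 'e) point \<Rightarrow> real) \<Rightarrow> ('v, 'e) point \<Rightarrow> int" where
  "ord_at \<Gamma> \<psi> (Vertex v) =
     (\<Sum>e\<in>{e \<in> edges \<Gamma>. head \<Gamma> e = v}. slope_from_tail \<Gamma> \<psi> e (edge_len \<Gamma> e)) +
     (\<Sum>e\<in>{e \<in> edges \<Gamma>. tail \<Gamma> e = v}. slope_from_head \<Gamma> \<psi> e 0)"
| "ord_at \<Gamma> \<psi> (Interior e t) = slope_from_tail \<Gamma> \<psi> e t + slope_from_head \<Gamma> \<psi> e t"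

type_synonym ('v, 'e) divisor = "('v, 'e) point \<Rightarrow>\<^sub>0 int"

abbreviation Div :: "('v, 'e) metric_graph \<Rightarrow> ('v, 'e) divisor set" where
  "Div \<Gamma> \<equiv> carrier (free_Abelian_group (points \<Gamma>))"

text \<open>For \<open>PL\<close> functions the order vanishes outside a finite set, so this is the formal sum of all orders.\<close>

definition div_of :: "('v, 'e) metric_graph \<Rightarrow> (('v, 'e) point \<Rightarrow> real) \<Rightarrow> ('v, 'e) divisor" where
  "div_of \<Gamma> \<psi> = (\<Sum>p | p \<in> points \<Gamma> \<and> ord_at \<Gamma> \<psi> p \<noteq> 0. frag_cmul (ord_at \<Gamma> \<psi> p) (frag_of p))"

definition equivalent ::
    "('v, 'e) metric_graph \<Rightarrow> ('v, 'e) divisor \<Rightarrow> ('v, 'e) divisor \<Rightarrow> bool" where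
  "equivalent \<Gamma> D D' \<longleftrightarrow> D \<in> Div \<Gamma> \<and> D' \<in> Div \<Gamma> \<and> (\<exists>\<psi>. PL \<Gamma> \<psi> \<and> D - D' = div_of \<Gamma> \<psi>)"


section \<open>Degree and rank\<close>

definition deg :: "('v, 'e) divisor \<Rightarrow> int" where
  "deg D = (\<Sum>p\<in>Poly_Mapping.keys D. Poly_Mapping.lookup D p)"

definition effective :: "('v, 'e) divisor \<Rightarrow> bool" where
  "effective D \<longleftrightarrow> (\<forall>p. 0 \<le> Poly_Mapping.lookup D p)"

definition equiv_effective :: "('v, 'e) metric_graph \<Rightarrow> ('v, 'e) divisor \<Rightarrow> bool" where
  "equiv_effective \<Gamma> D \<longleftrightarrow> (\<exists>D'. effective D' \<and> equivalent \<Gamma> D D')"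

text \<open>
  The \<open>GREATEST\<close> is a genuine maximum: \<open>r = 0\<close> qualifies in this branch, and the admissible
  \<open>r\<close> are bounded by the degree of \<open>D\<close>.
\<close>

definition divisor_rank :: "('v, 'e) metric_graph \<Rightarrow> ('v, 'e) divisor \<Rightarrow> int" where
  "divisor_rank \<Gamma> D =
     (if \<not> equiv_effective \<Gamma> D then - 1
      else int (GREATEST r. \<forall>E\<in>Div \<Gamma>. effective E \<and> deg E = int r \<longrightarrow> equiv_effective \<Gamma> (D - E)))"


section \<open>Chains of loops\<close>

datatype side = Top | Bottom

definition chain_of_loops ::
    "nat \<Rightarrow> (nat \<Rightarrow> real) \<Rightarrow> (nat \<Rightarrow> real) \<Rightarrow> (nat, nat \<times> side) metric_graph" where
  "chain_of_loops g l m =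
     \<lparr> verts = {0..g}, edges = {1..g} \<times> UNIV,
       tail = (\<lambda>(i, s). i - 1), head = (\<lambda>(i, s). i),
       edge_len = (\<lambda>(i, s). case s of Top \<Rightarrow> l i | Bottom \<Rightarrow> m i) \<rparr>"

text \<open>The bound \<open>2 * g - 2\<close> is taken in the integers: for \<open>g = 0\<close> it is negative.\<close>

definition generic_lengths :: "nat \<Rightarrow> (nat \<Rightarrow> real) \<Rightarrow> (nat \<Rightarrow> real) \<Rightarrow> bool" where
  "generic_lengths g l m \<longleftrightarrow>
     (\<forall>i\<in>{1..g}. \<not> (\<exists>a b :: int. 0 < a \<and> 0 < b \<and> a + b \<le> 2 * int g - 2 \<and>
        l i / m i = of_int a / of_int b))"

end

theory Submission
  imports Defs "HOL-Library.Real_Mod"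
begin

text \<open>
  Only the easy half of the Abel--Jacobi theorem is needed: equivalent divisors have the same degree
  and, for every loop \<open>i\<close>, the same sum \<open>x i\<close> of positions on that loop modulo \<open>l i + m i\<close>.
  Call \<open>K\<close> special for loop \<open>i\<close> if \<open>x i\<close> is the position sum of \<open>K\<close> chips at \<open>v\<^sub>i\<close>.  Move all
  \<open>d\<close> chips of \<open>D\<close> along the chain from \<open>v\<^sub>0\<close> to \<open>v\<^sub>g\<close>; passing loop \<open>i\<close> costs one
  chip unless the current number of chips is special, and by genericity at most one number in
  \<open>{0..d}\<close> is special for a given loop when \<open>d \<le> 2 g - 2\<close>.  If \<open>D\<close> has rank at least \<open>r\<close>, an
  adversary who removes \<open>r\<close> chips in total, at vertices of his choice, can never force a debt.
  Let \<open>M i j\<close> (\<open>least_chips\<close>) be the least number of chips at \<open>v\<^sub>i\<close> after \<open>j\<close> removals.  The \<open>M i j\<close> are distinct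
  for fixed \<open>i\<close>, so each loop lowers all but at most one of them; comparing \<open>\<Sum>j<r. M i j\<close> at both
  ends bounds from below the number of chips that \<open>D\<close> has away from \<open>v\<^sub>0\<close>, which is the claim.
  If \<open>r \<ge> g\<close>, removing one suitably chosen interior point on each loop already forces
  \<open>g \<le> d - r\<close>, and the claim is arithmetic.
\<close>

section \<open>A chip game on a chain\<close>

text \<open>
  \<open>sp i K\<close> means that \<open>K\<close> is special for loop \<open>i\<close>, and \<open>e i\<close> chips are removed at \<open>v\<^sub>i\<close>.
  \<open>stay sp g n\<close> counts, from right to left, the chips that the divisor reduced at \<open>v\<^sub>0\<close> has in the last
  \<open>n\<close> loops: at most one on each, and none on loop \<open>i\<close> exactly if the number of chips further
  right is special for \<open>i\<close>.
\<close>

definition pass :: "(nat \<Rightarrow> int \<Rightarrow> bool) \<Rightarrow> nat \<Rightarrow> int \<Rightarrow> int" where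
  "pass sp i K = K - of_bool (\<not> sp i K)"

primrec chips :: "(nat \<Rightarrow> int \<Rightarrow> bool) \<Rightarrow> int \<Rightarrow> (nat \<Rightarrow> nat) \<Rightarrow> nat \<Rightarrow> int" where
  "chips sp d e 0 = d - int (e 0)"
| "chips sp d e (Suc i) = pass sp (Suc i) (chips sp d e i) - int (e (Suc i))"

primrec stay :: "(nat \<Rightarrow> int \<Rightarrow> bool) \<Rightarrow> nat \<Rightarrow> nat \<Rightarrow> int" where
  "stay sp g 0 = 0"
| "stay sp g (Suc n) = stay sp g n + of_bool (\<not> sp (g - n) (stay sp g n))"

fun least_chips :: "(nat \<Rightarrow> int \<Rightarrow> bool) \<Rightarrow> int \<Rightarrow> nat \<Rightarrow> nat \<Rightarrow> int" where
  "least_chips sp d 0 j = d - int j"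
| "least_chips sp d (Suc i) 0 = pass sp (Suc i) (least_chips sp d i 0)"
| "least_chips sp d (Suc i) (Suc j) =
     min (pass sp (Suc i) (least_chips sp d i (Suc j))) (least_chips sp d (Suc i) j - 1)"

lemma pass_le: "pass sp i K \<le> K"
  by (simp add: pass_def)

lemma chips_cong: "(\<And>t. t \<le> i \<Longrightarrow> e t = e' t) \<Longrightarrow> chips sp d e i = chips sp d e' i"
  by (induction i) auto

lemma stay_nonneg: "0 \<le> stay sp g n"
  by (induction n) auto

lemma chips_fun_upd:
  "chips sp d (e(i := e i + k)) i = chips sp d e i - int k"
proof (cases i)
  case (Suc j)
  have "chips sp d (e(Suc j := e (Suc j) + k)) j = chips sp d e j"
    by (rule chips_cong) auto
  with Suc show ?thesis by simp
qed simp

lemma least_chips_attained: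
  "\<exists>e. (\<forall>t>i. e t = 0) \<and> (\<Sum>t\<le>i. e t) = j \<and> chips sp d e i = least_chips sp d i j"
proof (induction i arbitrary: j)
  case 0
  show ?case by (rule exI[of _ "(\<lambda>_. 0)(0 := j)"]) auto
next
  case (Suc i)
  have step: "\<exists>e. (\<forall>t>Suc i. e t = 0) \<and> (\<Sum>t\<le>Suc i. e t) = j \<and>
      chips sp d e (Suc i) = pass sp (Suc i) (least_chips sp d i j)" for j
    using Suc.IH[of j] by (metis (no_types, lifting) Suc_lessD add_0_right chips.simps(2)
        diff_zero lessI of_nat_0 sum.atMost_Suc)
  show ?case
  proof (induction j)
    case 0
    show ?case using step[of 0] by simp
  next
    case (Suc j)
    then obtain e where e: "\<forall>t>Suc i. e t = 0" "(\<Sum>t\<le>Suc i. e t) = j"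
      "chips sp d e (Suc i) = least_chips sp d (Suc i) j" by blast
    let ?e = "e(Suc i := e (Suc i) + 1)"
    have "(\<Sum>t\<le>i. ?e t) = (\<Sum>t\<le>i. e t)" by (intro sum.cong) auto
    then have "(\<forall>t>Suc i. ?e t = 0) \<and> (\<Sum>t\<le>Suc i. ?e t) = Suc j \<and>
        chips sp d ?e (Suc i) = least_chips sp d (Suc i) j - 1"
      using e chips_fun_upd[of sp d e "Suc i" 1] by simp
    then show ?case using step[of "Suc j"] by (simp only: least_chips.simps min_def) metis
  qed
qed

lemma least_chips_Suc_less: "least_chips sp d i (Suc j) < least_chips sp d i j"
  by (cases i) auto

lemma least_chips_inj: "inj (least_chips sp d i)"
proof (rule linorder_injI)
  fix a b :: nat assume "a < b"
  then show "least_chips sp d i a \<noteq> least_chips sp d i b"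
    using lift_Suc_mono_less[of "\<lambda>j. - least_chips sp d i j" a b] least_chips_Suc_less[of sp d i]
    by simp
qed

lemma least_chips_step: "least_chips sp d (Suc i) j \<le> pass sp (Suc i) (least_chips sp d i j)"
  by (cases j) auto

lemma least_chips_le: "least_chips sp d i j \<le> d"
proof (induction i)
  case (Suc i)
  then show ?case using least_chips_step[of sp d i j] pass_le[of sp "Suc i" "least_chips sp d i j"]
    by linarith
qed simp

locale chip_game =
  fixes g r :: nat and d :: int and sp :: "nat \<Rightarrow> int \<Rightarrow> bool"
  assumes special_unique:
      "\<lbrakk>i \<in> {1..g}; sp i a; sp i b; 0 \<le> a; a \<le> d; 0 \<le> b; b \<le> d\<rbrakk> \<Longrightarrow> a = b"
    and survive: "(\<Sum>t\<le>g. e t) = r \<Longrightarrow> 0 \<le> chips sp d e g"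
begin

text \<open>Falling below the number of chips still ahead is never repaired, hence ends in debt.\<close>

lemma chips_below_stay:
  assumes "i \<le> g" "chips sp d e i < stay sp g (g - i)"
  shows "chips sp d e g < 0"
  using assms
proof (induction i rule: inc_induct)
  case (step i)
  have "g - i = Suc (g - Suc i)" "g - (g - Suc i) = Suc i" using step by auto
  then have s: "stay sp g (g - i) =
      stay sp g (g - Suc i) + of_bool (\<not> sp (Suc i) (stay sp g (g - Suc i)))" by simp
  have "pass sp (Suc i) (chips sp d e i) < stay sp g (g - Suc i)"
  proof (cases "chips sp d e i < stay sp g (g - Suc i)")
    case False
    with step.prems s have "chips sp d e i = stay sp g (g - Suc i)"
      "\<not> sp (Suc i) (stay sp g (g - Suc i))" by (auto split: if_splits simp: of_bool_def)
    then show ?thesis by (simp add: pass_def)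
  qed (use pass_le[of sp "Suc i" "chips sp d e i"] in linarith)
  then show ?case using step.IH by simp
qed simp

lemma least_chips_ge:
  assumes "i \<le> g" "j \<le> r"
  shows "stay sp g (g - i) + int (r - j) \<le> least_chips sp d i j"
proof (rule ccontr)
  assume less: "\<not> ?thesis"
  obtain e where e: "\<forall>t>i. e t = 0" "(\<Sum>t\<le>i. e t) = j" "chips sp d e i = least_chips sp d i j"
    using least_chips_attained by blast
  let ?e = "e(i := e i + (r - j))"
  have "(\<Sum>t\<le>g. ?e t) = (\<Sum>t\<le>i. ?e t)"
    using assms e(1) by (intro sum.mono_neutral_right) auto
  also have "\<dots> = (\<Sum>t\<le>i. e t + (if t = i then r - j else 0))" by (intro sum.cong) auto
  also have "\<dots> = r" using e(2) assms(2) by (simp add: sum.distrib)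
  finally have "0 \<le> chips sp d ?e g" by (rule survive)
  moreover have "chips sp d ?e i < stay sp g (g - i)" 
    using less e(3) chips_fun_upd[of sp d e i "r - j"] by simp
  ultimately show False using chips_below_stay[OF assms(1), of ?e] by simp
qed

lemma sum_least_chips_step:
  assumes "i < g"
  shows "(\<Sum>j<r. least_chips sp d (Suc i) j)
      \<le> (\<Sum>j<r. least_chips sp d i j) - int r + (stay sp g (g - i) - stay sp g (g - Suc i))"
proof -
  let ?M = "least_chips sp d i" and ?s = "stay sp g (g - Suc i)"
  have "g - i = Suc (g - Suc i)" "g - (g - Suc i) = Suc i" using assms by auto
  then have s: "stay sp g (g - i) = ?s + of_bool (\<not> sp (Suc i) ?s)" by simp
  have bounds: "stay sp g (g - i) < ?M j" "?M j \<le> d" if "j < r" for j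
    using least_chips_ge[of i j] least_chips_le[of sp d i j] assms that by auto
  have eq: "a = b" if "a < r" "b < r" "sp (Suc i) (?M a)" "sp (Suc i) (?M b)" for a b
    using special_unique[of "Suc i" "?M a" "?M b"] that bounds[of a] bounds[of b]
      stay_nonneg[of sp g "g - i"] assms injD[OF least_chips_inj, of sp d i a b] by auto
  have count: "(\<Sum>j<r. of_bool (sp (Suc i) (?M j))) \<le> (of_bool (\<not> sp (Suc i) ?s) :: int)"
  proof (cases "\<exists>a<r. sp (Suc i) (?M a)")
    case True
    then obtain a where a: "a < r" "sp (Suc i) (?M a)" by blast
    have "\<not> sp (Suc i) ?s"
    proof
      assume "sp (Suc i) ?s"
      then have "?s = ?M a"
        using special_unique[of "Suc i" ?s "?M a"] a bounds[of a] s assms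
          stay_nonneg[of sp g "g - Suc i"] by auto
      with bounds[OF a(1)] s show False by (auto simp: of_bool_def split: if_splits)
    qed
    moreover have "(\<Sum>j<r. of_bool (sp (Suc i) (?M j))) = (\<Sum>j<r. if j = a then 1 else (0::int))"
      using a eq by (intro sum.cong) auto
    ultimately show ?thesis using a by simp
  next
    case False
    then show ?thesis by simp
  qed
  have "(\<Sum>j<r. least_chips sp d (Suc i) j) \<le> (\<Sum>j<r. ?M j - 1 + of_bool (sp (Suc i) (?M j)))"
  proof (rule sum_mono)
    fix j
    show "least_chips sp d (Suc i) j \<le> ?M j - 1 + of_bool (sp (Suc i) (?M j))"
      using least_chips_step[of sp d i j] by (simp add: pass_def of_bool_def split: if_splits)
  qed
  also have "\<dots> = (\<Sum>j<r. ?M j) - int r + (\<Sum>j<r. of_bool (sp (Suc i) (?M j)))"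
    by (simp add: sum.distrib sum_subtractf)
  finally show ?thesis using count s by linarith
qed

lemma sum_least_chips:
  "i \<le> g \<Longrightarrow> (\<Sum>j<r. least_chips sp d i j)
     \<le> (\<Sum>j<r. d - int j) - int i * int r + (stay sp g g - stay sp g (g - i))"
proof (induction i)
  case (Suc i)
  then show ?case using sum_least_chips_step[of i] by (simp add: algebra_simps)
qed simp

lemma stay_upper: "stay sp g g \<le> d - int r"
  using least_chips_ge[of 0 r] by simp

lemma stay_lower: "int r * (int g - d + int r) \<le> stay sp g g"
proof -
  have "(\<Sum>j<r. int r - int j) \<le> (\<Sum>j<r. least_chips sp d g j)"
    using least_chips_ge[of g] by (intro sum_mono) force
  with sum_least_chips[of g] show ?thesis by (simp add: sum_subtractf algebra_simps)
qed

end


section \<open>Pairing divisors with functions\<close>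

definition pairing :: "('a \<Rightarrow> 'b::comm_ring_1) \<Rightarrow> ('a \<Rightarrow>\<^sub>0 int) \<Rightarrow> 'b" where
  "pairing h D = (\<Sum>p\<in>Poly_Mapping.keys D. of_int (Poly_Mapping.lookup D p) * h p)"

lemma pairing_superset:
  assumes "finite A" "Poly_Mapping.keys D \<subseteq> A"
  shows "pairing h D = (\<Sum>p\<in>A. of_int (Poly_Mapping.lookup D p) * h p)"
  unfolding pairing_def using assms
  by (intro sum.mono_neutral_left) (auto simp: in_keys_iff)

lemma pairing_add: "pairing h (D + E) = pairing h D + pairing h E"
proof -
  let ?A = "Poly_Mapping.keys D \<union> Poly_Mapping.keys E"
  have "finite ?A" "Poly_Mapping.keys (D + E) \<subseteq> ?A"
    using Poly_Mapping.keys_add[of D E] by auto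
  then show ?thesis
    by (simp add: pairing_superset[of ?A] lookup_add sum.distrib algebra_simps)
qed

lemma pairing_0 [simp]: "pairing h 0 = 0"
  by (simp add: pairing_def)

lemma pairing_diff: "pairing h (D - E) = pairing h D - pairing h E"
  using pairing_add[of h "D - E" E] by simp

lemma pairing_frag [simp]: "pairing h (frag_cmul c (frag_of p)) = of_int c * h p"
  by (subst pairing_superset[of "{p}"]) auto

lemma pairing_frag_of [simp]: "pairing h (frag_of p) = h p"
  using pairing_frag[of h 1 p] by simp

lemma pairing_sum: "pairing h (sum F A) = (\<Sum>a\<in>A. pairing h (F a))"
  by (induction A rule: infinite_finite_induct) (auto simp: pairing_add)

lemma deg_conv_pairing: "deg D = pairing (\<lambda>_. 1) D"
  by (simp add: deg_def pairing_def)

lemma pairing_mono: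
  fixes h k :: "'a \<Rightarrow> 'b::linordered_idom"
  assumes "\<And>p. 0 \<le> Poly_Mapping.lookup D p" "\<And>p. p \<in> Poly_Mapping.keys D \<Longrightarrow> h p \<le> k p"
  shows "pairing h D \<le> pairing k D"
  unfolding pairing_def using assms by (intro sum_mono mult_left_mono) auto

lemma pairing_cong:
  "(\<And>p. p \<in> Poly_Mapping.keys D \<Longrightarrow> h p = k p) \<Longrightarrow> pairing h D = pairing k D"
  unfolding pairing_def by (intro sum.cong) auto

lemma pairing_mult_of_int:
  fixes h :: "'a \<Rightarrow> int"
  shows "pairing (\<lambda>p. c * of_int (h p)) D = c * of_int (pairing h D)"
  by (simp add: pairing_def sum_distrib_left mult_ac)

lemma pairing_eq_imp_eq:
  fixes h k :: "'a \<Rightarrow> 'b::linordered_idom"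
  assumes nonneg: "\<And>p. 0 \<le> Poly_Mapping.lookup D p"
    and le: "\<And>p. p \<in> Poly_Mapping.keys D \<Longrightarrow> h p \<le> k p"
    and eq: "pairing k D \<le> pairing h D" and p: "p \<in> Poly_Mapping.keys D"
  shows "h p = k p"
proof (rule ccontr)
  let ?c = "\<lambda>q. of_int (Poly_Mapping.lookup D q) :: 'b"
  assume "h p \<noteq> k p"
  then have "h p < k p" using le[OF p] by simp
  moreover have "0 < Poly_Mapping.lookup D p"
    using nonneg[of p] p by (simp add: in_keys_iff le_less)
  ultimately have "(\<Sum>q\<in>Poly_Mapping.keys D. ?c q * h q) < (\<Sum>q\<in>Poly_Mapping.keys D. ?c q * k q)"
    using nonneg le p by (intro sum_strict_mono_ex1) (auto intro!: mult_left_mono bexI[of _ p])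
  with eq show False by (simp add: pairing_def)
qed

lemma pairing_indicator: "pairing (\<lambda>p. of_bool (p = q)) D = Poly_Mapping.lookup D q"
  by (subst pairing_superset[of "insert q (Poly_Mapping.keys D)"])
    (auto simp: of_bool_def if_distrib cong: if_cong)

lemma pairing_add_indicator:
  "pairing (\<lambda>p. h p + of_bool (p = q)) D = pairing h D + Poly_Mapping.lookup D q"
  by (subst pairing_indicator[of q D, symmetric]) (simp add: pairing_def sum.distrib distrib_left)


section \<open>Slope sums of piecewise linear functions\<close>

definition slopes_on :: "real set \<Rightarrow> (real \<Rightarrow> real) \<Rightarrow> bool" where
  "slopes_on S f \<longleftrightarrow> (\<forall>a\<in>S. \<forall>b\<in>S. a < b \<and> S \<inter> {a<..<b} = {} \<longrightarrow>
     (\<exists>(k::int) c. \<forall>t\<in>{a..b}. f t = c + of_int k * t))"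

definition left_slope :: "(real \<Rightarrow> real) \<Rightarrow> real \<Rightarrow> int" where
  "left_slope f t = (THE k. \<forall>\<^sub>F u in at_left t. f t = f u + of_int k * (t - u))"

definition right_slope :: "(real \<Rightarrow> real) \<Rightarrow> real \<Rightarrow> int" where
  "right_slope f t = (THE k. \<forall>\<^sub>F u in at_right t. f t = f u + of_int k * (u - t))"

lemma left_slope_eq:
  assumes "a < t" "\<And>u. u \<in> {a..t} \<Longrightarrow> f u = c + of_int k * u"
  shows "left_slope f t = k"
  unfolding left_slope_def
proof (rule the_equality)
  have ev: "\<forall>\<^sub>F u in at_left t. f t - f u = of_int k * (t - u) \<and> u < t"
    using eventually_at_left_real[OF assms(1)]
    by eventually_elim (use assms in \<open>auto simp: algebra_simps\<close>)
  then show "\<forall>\<^sub>F u in at_left t. f t = f u + of_int k * (t - u)"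
    by eventually_elim linarith
  fix j assume "\<forall>\<^sub>F u in at_left t. f t = f u + of_int j * (t - u)"
  with ev have "\<forall>\<^sub>F u in at_left t. of_int j * (t - u) = of_int k * (t - u) \<and> u < t"
    by eventually_elim linarith
  then have "\<forall>\<^sub>F u in at_left t. j = k" by eventually_elim auto
  then show "j = k" by simp
qed

lemma right_slope_eq:
  assumes "t < b" "\<And>u. u \<in> {t..b} \<Longrightarrow> f u = c + of_int k * u"
  shows "right_slope f t = - k"
  unfolding right_slope_def
proof (rule the_equality)
  have ev: "\<forall>\<^sub>F u in at_right t. f t - f u = of_int (-k) * (u - t) \<and> t < u"
    using eventually_at_right_real[OF assms(1)]
    by eventually_elim (use assms in \<open>auto simp: algebra_simps\<close>)
  then show "\<forall>\<^sub>F u in at_right t. f t = f u + of_int (-k) * (u - t)"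
    by eventually_elim linarith
  fix j assume "\<forall>\<^sub>F u in at_right t. f t = f u + of_int j * (u - t)"
  with ev have "\<forall>\<^sub>F u in at_right t. of_int j * (u - t) = of_int (-k) * (u - t) \<and> t < u"
    by eventually_elim linarith
  then have "\<forall>\<^sub>F u in at_right t. j = -k" by eventually_elim (metis diff_gt_0_iff_gt less_irrefl mult_right_cancel of_int_eq_iff)
  then show "j = - k" by simp
qed

lemma slopes_on_adjacent:
  assumes "slopes_on S f" "a \<in> S" "b \<in> S" "a < b" "S \<inter> {a<..<b} = {}"
  obtains k c where "\<And>u. u \<in> {a..b} \<Longrightarrow> f u = c + of_int k * u"
  using assms unfolding slopes_on_def by meson

lemma predecessor_in_finite:
  fixes t :: real
  assumes "finite S" "x \<in> S" "x < t"
  shows "\<exists>a\<in>S. x \<le> a \<and> a < t \<and> S \<inter> {a<..<t} = {}"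
proof -
  let ?A = "{s \<in> S. s < t}"
  have A: "finite ?A" "x \<in> ?A" using assms by auto
  then have "Max ?A \<in> ?A" by (intro Max_in) blast+
  moreover have "s \<le> Max ?A" if "s \<in> S" "s < t" for s
    using A(1) that by simp
  moreover from this have "S \<inter> {Max ?A<..<t} = {}"
    by (auto simp: disjoint_iff simp flip: not_le)
  ultimately show ?thesis using assms(2,3) by blast
qed

lemma successor_in_finite:
  fixes t :: real
  assumes "finite S" "x \<in> S" "t < x"
  shows "\<exists>b\<in>S. b \<le> x \<and> t < b \<and> S \<inter> {t<..<b} = {}"
proof -
  let ?A = "{s \<in> S. t < s}"
  have A: "finite ?A" "x \<in> ?A" using assms by auto
  then have "Min ?A \<in> ?A" by (intro Min_in) blast+
  moreover have "Min ?A \<le> s" if "s \<in> S" "t < s" for s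
    using A(1) that by simp
  moreover from this have "S \<inter> {t<..<Min ?A} = {}"
    by (auto simp: disjoint_iff simp flip: not_le)
  ultimately show ?thesis using assms(2,3) by blast
qed

lemma sum_slopes:
  fixes S :: "real set" and \<alpha> \<beta> :: real
  assumes S: "finite S" "0 \<in> S" "S \<subseteq> {0..}" and f: "slopes_on S f"
  assumes "b \<in> S" "0 < b"
    and h: "\<And>t. h t = \<alpha> + \<beta> * t"
  shows "(\<Sum>t\<in>S \<inter> {0<..<b}. of_int (left_slope f t + right_slope f t) * h t)
     + of_int (right_slope f 0) * h 0 + of_int (left_slope f b) * h b = \<beta> * (f b - f 0)"
  using assms(5,6)
proof (induction "card (S \<inter> {0<..<b})" arbitrary: b rule: less_induct)
  case less
  obtain a where a: "a \<in> S" "0 \<le> a" "a < b" "S \<inter> {a<..<b} = {}"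
    using predecessor_in_finite[OF S(1,2) less.prems(2)] by blast
  obtain k c where kc: "\<And>u. u \<in> {a..b} \<Longrightarrow> f u = c + of_int k * u"
    using slopes_on_adjacent[OF f a(1) less.prems(1) a(3,4)] by metis
  have slopes: "left_slope f b = k" "right_slope f a = - k"
    using left_slope_eq[OF a(3) kc] right_slope_eq[OF a(3) kc] by auto
  have fb: "f b - f a = of_int k * (b - a)"
    using kc[of a] kc[of b] a by (auto simp: algebra_simps)
  have step: "of_int k * h b - of_int k * h a = \<beta> * (f b - f a)"
    unfolding fb h by algebra
  show ?case
  proof (cases "a = 0")
    case True
    then have "S \<inter> {0<..<b} = {}" using a by simp
    then show ?thesis using True slopes step by simp
  next
    case False
    then have "0 < a" using a by simp
    then have ins: "S \<inter> {0<..<b} = insert a (S \<inter> {0<..<a})" using a by auto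
    then have "card (S \<inter> {0<..<a}) < card (S \<inter> {0<..<b})" using S(1) by simp
    from less.hyps[OF this a(1) \<open>0 < a\<close>] show ?thesis
      using slopes step S(1) unfolding ins by (simp add: algebra_simps)
  qed
qed

lemma left_slope_right_slope_smooth:
  assumes "finite S" "0 \<in> S" "b \<in> S" "slopes_on S f" "t \<in> {0<..<b}" "t \<notin> S"
  shows "left_slope f t + right_slope f t = 0"
proof -
  obtain a where a: "a \<in> S" "a < t" "S \<inter> {a<..<t} = {}"
    using predecessor_in_finite[of S 0 t] assms(1,2,5) by auto
  obtain b' where b': "b' \<in> S" "t < b'" "S \<inter> {t<..<b'} = {}"
    using successor_in_finite[of S b t] assms(1,3,5) by auto
  have "s \<notin> {a<..<b'}" if "s \<in> S" for s
    using a(3) b'(3) assms(6) that by (cases s t rule: linorder_cases) (auto simp: disjoint_iff)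
  then have "S \<inter> {a<..<b'} = {}" by blast
  then obtain k c where kc: "\<And>u. u \<in> {a..b'} \<Longrightarrow> f u = c + of_int k * u"
    using slopes_on_adjacent[OF assms(4) a(1) b'(1)] a(2) b'(2) by (metis less_trans)
  have "left_slope f t = k" by (rule left_slope_eq[OF a(2)]) (use kc b' in auto)
  moreover have "right_slope f t = -k" by (rule right_slope_eq[OF b'(2)]) (use kc a in auto)
  ultimately show ?thesis by simp
qed

lemma slope_from_tail_eq: "slope_from_tail \<Gamma> \<psi> e = left_slope (\<lambda>t. \<psi> (edge_point \<Gamma> e t))"
  by (simp add: slope_from_tail_def left_slope_def fun_eq_iff)

lemma slope_from_head_eq: "slope_from_head \<Gamma> \<psi> e = right_slope (\<lambda>t. \<psi> (edge_point \<Gamma> e t))"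
  by (simp add: slope_from_head_def right_slope_def fun_eq_iff)

locale finite_metric_graph =
  fixes \<Gamma> :: "('v, 'e) metric_graph"
  assumes finite_verts: "finite (verts \<Gamma>)" and finite_edges: "finite (edges \<Gamma>)"
    and tail_verts: "tail \<Gamma> ` edges \<Gamma> \<subseteq> verts \<Gamma>" and head_verts: "head \<Gamma> ` edges \<Gamma> \<subseteq> verts \<Gamma>"
    and edge_len_pos: "e \<in> edges \<Gamma> \<Longrightarrow> 0 < edge_len \<Gamma> e"
begin

lemma pairing_div_of:
  fixes h :: "('v, 'e) point \<Rightarrow> real" and \<alpha> \<beta> :: "'e \<Rightarrow> real"
  assumes PL: "PL \<Gamma> \<psi>"
    and h: "\<And>e t. \<lbrakk>e \<in> edges \<Gamma>; 0 \<le> t; t < edge_len \<Gamma> e\<rbrakk> \<Longrightarrow> h (edge_point \<Gamma> e t) = \<alpha> e + \<beta> e * t"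
  shows "pairing h (div_of \<Gamma> \<psi>) = (\<Sum>e\<in>edges \<Gamma>.
      \<beta> e * (\<psi> (Vertex (head \<Gamma> e)) - \<psi> (Vertex (tail \<Gamma> e))) +
      of_int (slope_from_tail \<Gamma> \<psi> e (edge_len \<Gamma> e)) *
        (h (Vertex (head \<Gamma> e)) - (\<alpha> e + \<beta> e * edge_len \<Gamma> e)))"
proof -
  let ?f = "\<lambda>e t. \<psi> (edge_point \<Gamma> e t)" and ?len = "edge_len \<Gamma>"
  have "\<forall>e\<in>edges \<Gamma>. \<exists>S. finite S \<and> {0, ?len e} \<subseteq> S \<and> S \<subseteq> {0..?len e} \<and> slopes_on S (?f e)"
    using PL unfolding PL_def slopes_on_def by blast
  then obtain S where "\<forall>e\<in>edges \<Gamma>. finite (S e) \<and> {0, ?len e} \<subseteq> S e \<and> S e \<subseteq> {0..?len e} \<and>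
      slopes_on (S e) (?f e)" by metis
  then have S: "finite (S e)" "0 \<in> S e" "?len e \<in> S e" "S e \<subseteq> {0..?len e}" "slopes_on (S e) (?f e)"
    if "e \<in> edges \<Gamma>" for e using that by auto
  define I where "I = (\<lambda>e. S e \<inter> {0<..<?len e})"
  define J where "J = (\<lambda>(e, t). Interior e t :: ('v, 'e) point) ` Sigma (edges \<Gamma>) I"
  define B where "B = Vertex ` verts \<Gamma> \<union> J"
  have finB: "finite B" using finite_verts finite_edges S by (auto simp: B_def I_def J_def intro!: finite_SigmaI)
  have "{p. p \<in> points \<Gamma> \<and> ord_at \<Gamma> \<psi> p \<noteq> 0} \<subseteq> B"
  proof
    fix p assume p: "p \<in> {p. p \<in> points \<Gamma> \<and> ord_at \<Gamma> \<psi> p \<noteq> 0}"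
    show "p \<in> B"
    proof (cases p)
      case (Vertex v)
      with p show ?thesis by (auto simp: points_def B_def)
    next
      case (Interior e t)
      with p have e: "e \<in> edges \<Gamma>" "0 < t" "t < ?len e"
        and ord: "left_slope (?f e) t + right_slope (?f e) t \<noteq> 0"
        by (auto simp: points_def slope_from_tail_eq slope_from_head_eq)
      have "t \<in> S e"
        using left_slope_right_slope_smooth[of "S e" "?len e" "?f e" t] S[OF e(1)] e ord by auto
      with e Interior show ?thesis by (auto simp: B_def I_def J_def)
    qed
  qed
  moreover have "B \<subseteq> points \<Gamma>" by (auto simp: B_def I_def J_def points_def)
  ultimately have "pairing h (div_of \<Gamma> \<psi>) = (\<Sum>p\<in>B. of_int (ord_at \<Gamma> \<psi> p) * h p)"
    unfolding div_of_def pairing_sum pairing_frag using finB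
    by (intro sum.mono_neutral_left) auto
  also have "\<dots> = (\<Sum>p\<in>Vertex ` verts \<Gamma>. of_int (ord_at \<Gamma> \<psi> p) * h p) +
      (\<Sum>p\<in>J. of_int (ord_at \<Gamma> \<psi> p) * h p)"
    unfolding B_def using finB by (intro sum.union_disjoint) (auto simp: B_def J_def)
  also have "(\<Sum>p\<in>Vertex ` verts \<Gamma>. of_int (ord_at \<Gamma> \<psi> p) * h p) =
      (\<Sum>v\<in>verts \<Gamma>. of_int (ord_at \<Gamma> \<psi> (Vertex v)) * h (Vertex v))"
    by (subst sum.reindex) (auto simp: inj_on_def)
  also have "\<dots> =
     (\<Sum>v\<in>verts \<Gamma>. \<Sum>e\<in>{e \<in> edges \<Gamma>. head \<Gamma> e = v}.
        of_int (left_slope (?f e) (?len e)) * h (Vertex (head \<Gamma> e))) +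
     (\<Sum>v\<in>verts \<Gamma>. \<Sum>e\<in>{e \<in> edges \<Gamma>. tail \<Gamma> e = v}.
        of_int (right_slope (?f e) 0) * h (Vertex (tail \<Gamma> e)))"
    by (simp add: slope_from_tail_eq slope_from_head_eq algebra_simps sum.distrib sum_distrib_left)
  also have "\<dots> = (\<Sum>e\<in>edges \<Gamma>. of_int (left_slope (?f e) (?len e)) * h (Vertex (head \<Gamma> e))) +
      (\<Sum>e\<in>edges \<Gamma>. of_int (right_slope (?f e) 0) * h (Vertex (tail \<Gamma> e)))"
    by (simp only: sum.group[OF finite_edges finite_verts head_verts] sum.group[OF finite_edges finite_verts tail_verts])
  also have "(\<Sum>p\<in>J. of_int (ord_at \<Gamma> \<psi> p) * h p) = (\<Sum>e\<in>edges \<Gamma>. \<Sum>t\<in>I e.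
      of_int (left_slope (?f e) t + right_slope (?f e) t) * h (Interior e t))"
    unfolding J_def using finite_edges S
    by (subst sum.reindex) (auto simp: inj_on_def I_def sum.Sigma slope_from_tail_eq
        slope_from_head_eq split_def)
  finally have "pairing h (div_of \<Gamma> \<psi>) = (\<Sum>e\<in>edges \<Gamma>.
      (\<Sum>t\<in>I e. of_int (left_slope (?f e) t + right_slope (?f e) t) * h (Interior e t)) +
      of_int (right_slope (?f e) 0) * h (Vertex (tail \<Gamma> e)) +
      of_int (left_slope (?f e) (?len e)) * h (Vertex (head \<Gamma> e)))"
    by (simp add: sum.distrib)
  also have "\<dots> = (\<Sum>e\<in>edges \<Gamma>.
      \<beta> e * (\<psi> (Vertex (head \<Gamma> e)) - \<psi> (Vertex (tail \<Gamma> e))) +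
      of_int (slope_from_tail \<Gamma> \<psi> e (?len e)) *
        (h (Vertex (head \<Gamma> e)) - (\<alpha> e + \<beta> e * ?len e)))"
  proof (rule sum.cong[OF refl])
    fix e assume e: "e \<in> edges \<Gamma>"
    have ep: "edge_point \<Gamma> e 0 = Vertex (tail \<Gamma> e)" "edge_point \<Gamma> e (?len e) = Vertex (head \<Gamma> e)"
      using edge_len_pos[OF e] by (auto simp: edge_point_def)
    have "h (Interior e t) = \<alpha> e + \<beta> e * t" if "t \<in> I e" for t
      using h[OF e, of t] that by (auto simp: I_def edge_point_def)
    then have "(\<Sum>t\<in>I e. of_int (left_slope (?f e) t + right_slope (?f e) t) * h (Interior e t)) =
        (\<Sum>t\<in>I e. of_int (left_slope (?f e) t + right_slope (?f e) t) * (\<alpha> e + \<beta> e * t))"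
      by simp
    moreover have "h (Vertex (tail \<Gamma> e)) = \<alpha> e"
      using h[OF e, of 0] edge_len_pos[OF e] ep by simp
    moreover have "S e \<subseteq> {0..}" using S(4)[OF e] by auto
    note sum_slopes[OF S(1,2)[OF e] this S(5,3)[OF e] edge_len_pos[OF e] refl, of "\<alpha> e" "\<beta> e"]
    ultimately show "(\<Sum>t\<in>I e. of_int (left_slope (?f e) t + right_slope (?f e) t) * h (Interior e t)) +
      of_int (right_slope (?f e) 0) * h (Vertex (tail \<Gamma> e)) +
      of_int (left_slope (?f e) (?len e)) * h (Vertex (head \<Gamma> e)) =
      \<beta> e * (\<psi> (Vertex (head \<Gamma> e)) - \<psi> (Vertex (tail \<Gamma> e))) +
      of_int (slope_from_tail \<Gamma> \<psi> e (?len e)) *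
        (h (Vertex (head \<Gamma> e)) - (\<alpha> e + \<beta> e * ?len e))"
      using ep
      by (auto simp: slope_from_tail_eq I_def algebra_simps)
  qed
  finally show ?thesis .
qed

lemma deg_div_of: "PL \<Gamma> \<psi> \<Longrightarrow> deg (div_of \<Gamma> \<psi>) = 0"
  using pairing_div_of[of \<psi> "\<lambda>_. 1" "\<lambda>_. 1" "\<lambda>_. 0"]
    pairing_mult_of_int[of "1 :: real" "\<lambda>_. 1" "div_of \<Gamma> \<psi>"]
  by (simp add: deg_conv_pairing)

lemma divisor_rank_ge_imp:
  assumes "verts \<Gamma> \<noteq> {}" and D: "D \<in> Div \<Gamma>" and rank: "int r \<le> divisor_rank \<Gamma> D"
    and E: "E \<in> Div \<Gamma>" "effective E" "deg E = int r"
  obtains F \<psi> where "effective F" "effective (F - E)" "PL \<Gamma> \<psi>" "D - F = div_of \<Gamma> \<psi>"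
proof -
  obtain v where v: "Vertex v \<in> points \<Gamma>" using assms(1) by (auto simp: points_def)
  define V where "V = (\<lambda>k::nat. frag_cmul (int k) (frag_of (Vertex v)) :: ('v, 'e) divisor)"
  have V: "V k \<in> Div \<Gamma>" "effective (V k)" "deg (V k) = int k" for k
    using v by (auto simp: V_def effective_def deg_conv_pairing carrier_free_Abelian_group_iff)
  define P where
    "P = (\<lambda>r. \<forall>E\<in>Div \<Gamma>. effective E \<and> deg E = int r \<longrightarrow> equiv_effective \<Gamma> (D - E))"
  have eff: "equiv_effective \<Gamma> D" and G: "r \<le> (GREATEST r. P r)"
    using rank by (auto simp: divisor_rank_def P_def split: if_splits)
  have "P 0"
    unfolding P_def
  proof (intro ballI impI; elim conjE)
    fix E :: "('v, 'e) divisor" assume E: "effective E" "deg E = int 0"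
    have "Poly_Mapping.lookup E p = 0" for p
      using E by (cases "p \<in> Poly_Mapping.keys E")
        (auto simp: deg_def effective_def sum_nonneg_eq_0_iff in_keys_iff)
    then have "E = 0" by (intro poly_mapping_eqI) simp
    with eff show "equiv_effective \<Gamma> (D - E)" by simp
  qed
  moreover have "k \<le> nat (deg D)" if "P k" for k
  proof -
    have "equiv_effective \<Gamma> (D - V k)" using that V[of k] by (auto simp: P_def)
    then obtain D' \<psi> where D': "effective D'" "PL \<Gamma> \<psi>" "D - V k - D' = div_of \<Gamma> \<psi>"
      by (auto simp: equiv_effective_def equivalent_def)
    then have "deg D - int k - deg D' = 0"
      using deg_div_of[OF D'(2)] V(3)[of k] by (simp add: deg_conv_pairing pairing_diff flip: D'(3))
    moreover have "0 \<le> deg D'" using D'(1) by (auto simp: effective_def deg_def intro: sum_nonneg)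
    ultimately show ?thesis by simp
  qed
  ultimately have PG: "P (GREATEST r. P r)" by (rule GreatestI_nat)
  define k where "k = (GREATEST r. P r) - r"
  have "Poly_Mapping.keys (E + V k) \<subseteq> points \<Gamma>"
    using Poly_Mapping.keys_add[of E "V k"] E(1) V(1)[of k] by (auto simp: carrier_free_Abelian_group_iff)
  then have "E + V k \<in> Div \<Gamma>" by (simp add: carrier_free_Abelian_group_iff)
  moreover have "effective (E + V k)" "deg (E + V k) = int (GREATEST r. P r)"
    using E(2,3) V(2,3)[of k] G
    by (auto simp: effective_def lookup_add deg_conv_pairing pairing_add k_def)
  ultimately have "equiv_effective \<Gamma> (D - (E + V k))" using PG by (auto simp: P_def)
  then obtain D' \<psi> where D': "effective D'" "PL \<Gamma> \<psi>" "D - (E + V k) - D' = div_of \<Gamma> \<psi>"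
    by (auto simp: equiv_effective_def equivalent_def)
  show thesis
  proof (rule that)
    show "effective (D' + (E + V k))" "effective (D' + (E + V k) - E)"
      using D'(1) E(2) V(2)[of k] by (auto simp: effective_def lookup_add lookup_minus)
    show "D - (D' + (E + V k)) = div_of \<Gamma> \<psi>" using D'(3) by (simp add: algebra_simps)
  qed fact
qed

end


section \<open>Divisors on a chain of loops\<close>

text \<open>
  The position of a point after retracting the chain to loop \<open>i\<close>, measured from \<open>v\<^bsub>i-1\<^esub>\<close> along the
  bottom edge; it is meaningful modulo \<open>l i + m i\<close>, which is why the top edge counts negatively.
\<close>

fun loop_pos :: "(nat \<Rightarrow> real) \<Rightarrow> nat \<Rightarrow> (nat, nat \<times> side) point \<Rightarrow> real" where
  "loop_pos m i (Vertex v) = (if v < i then 0 else m i)"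
| "loop_pos m i (Interior (j, s) t) =
     (if j < i then 0 else if i < j then m i else case s of Top \<Rightarrow> - t | Bottom \<Rightarrow> t)"

fun from_vertex :: "nat \<Rightarrow> (nat, nat \<times> side) point \<Rightarrow> int" where
  "from_vertex i (Vertex v) = of_bool (i \<le> v)"
| "from_vertex i (Interior (j, s) t) = of_bool (i < j)"

fun beyond_vertex :: "nat \<Rightarrow> (nat, nat \<times> side) point \<Rightarrow> int" where
  "beyond_vertex i (Vertex v) = of_bool (i < v)"
| "beyond_vertex i (Interior (j, s) t) = of_bool (i < j)"

lemma from_vertex_Suc_le: "from_vertex (Suc i) p + of_bool (p = Vertex i) \<le> from_vertex i p"
  by (cases "(i, p)" rule: from_vertex.cases) auto

lemma loop_pos_eq_from_vertex:
  "from_vertex (Suc i) p + of_bool (p = Vertex i) = from_vertex i p \<Longrightarrow>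
    loop_pos m (Suc i) p = m (Suc i) * of_int (from_vertex (Suc i) p)"
  by (cases "(i, p)" rule: from_vertex.cases) (auto split: if_splits simp: of_bool_def)

lemma beyond_vertex_Suc_le: "beyond_vertex (Suc i) p \<le> beyond_vertex i p"
  by (cases "(i, p)" rule: beyond_vertex.cases) auto

lemma loop_pos_eq_beyond_vertex:
  "beyond_vertex (Suc i) p = beyond_vertex i p \<Longrightarrow>
    loop_pos m (Suc i) p = m (Suc i) * of_int (beyond_vertex (Suc i) p)"
  by (cases "(i, p)" rule: beyond_vertex.cases) (auto split: if_splits simp: of_bool_def)

lemma UNIV_side: "UNIV = {Top, Bottom}"
  by (auto intro: side.exhaust)

locale loop_chain =
  fixes g :: nat and l m :: "nat \<Rightarrow> real"
  assumes top_pos: "i \<in> {1..g} \<Longrightarrow> 0 < l i" and bottom_pos: "i \<in> {1..g} \<Longrightarrow> 0 < m i"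
begin

abbreviation \<Gamma> where "\<Gamma> \<equiv> chain_of_loops g l m"

sublocale finite_metric_graph \<Gamma>
proof
  show "finite (edges \<Gamma>)"
    by (auto simp: chain_of_loops_def UNIV_side intro!: finite_cartesian_product)
qed (auto simp: chain_of_loops_def top_pos bottom_pos split: side.split)

definition special :: "(nat, nat \<times> side) divisor \<Rightarrow> nat \<Rightarrow> int \<Rightarrow> bool" where
  "special D i K \<longleftrightarrow> [pairing (loop_pos m i) D = m i * of_int K] (rmod (l i + m i))"

lemma loop_pos_div_of:
  assumes PL: "PL \<Gamma> \<psi>" and i: "i \<in> {1..g}"
  shows "[pairing (loop_pos m i) (div_of \<Gamma> \<psi>) = 0] (rmod (l i + m i))"
proof -
  let ?\<alpha> = "\<lambda>(j, s :: side). if j \<le> i then 0 else m i"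
  let ?\<beta> = "\<lambda>(j, s). if j = i then (case s of Top \<Rightarrow> - 1 | Bottom \<Rightarrow> 1) else 0 :: real"
  let ?slope = "\<lambda>e. slope_from_tail \<Gamma> \<psi> e (edge_len \<Gamma> e)"
  let ?term = "\<lambda>e. ?\<beta> e * (\<psi> (Vertex (head \<Gamma> e)) - \<psi> (Vertex (tail \<Gamma> e))) +
      of_int (?slope e) * (loop_pos m i (Vertex (head \<Gamma> e)) - (?\<alpha> e + ?\<beta> e * edge_len \<Gamma> e))"
  have "pairing (loop_pos m i) (div_of \<Gamma> \<psi>) = (\<Sum>e\<in>edges \<Gamma>. ?term e)"
    by (rule pairing_div_of[OF PL])
      (auto simp: chain_of_loops_def edge_point_def split: side.split)
  also have "\<dots> = (\<Sum>e\<in>{(i, Top), (i, Bottom)}. ?term e)"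
  proof (intro sum.mono_neutral_right finite_edges ballI)
    show "{(i, Top), (i, Bottom)} \<subseteq> edges \<Gamma>" using i by (auto simp: chain_of_loops_def)
    fix e assume "e \<in> edges \<Gamma> - {(i, Top), (i, Bottom)}"
    then obtain j s where "e = (j, s)" "j \<noteq> i" "1 \<le> j"
      by (cases e; cases "snd e") (auto simp: chain_of_loops_def)
    then show "?term e = 0" by (auto simp: chain_of_loops_def)
  qed
  also have "\<dots> = of_int (?slope (i, Top)) * (l i + m i)"
    by (simp add: chain_of_loops_def algebra_simps)
  finally show ?thesis by (metis rcong_mult_of_int_0_left_right)
qed

lemma stay_le_beyond:
  assumes "effective D" "n \<le> g"
  shows "stay (special D) g n \<le> pairing (beyond_vertex (g - n)) D"
  using assms(2)
proof (induction n)
  case 0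
  have "0 \<le> beyond_vertex g p" for p by (cases "(g, p)" rule: beyond_vertex.cases) auto
  then show ?case using assms(1) by (auto simp: pairing_def effective_def intro!: sum_nonneg)
next
  case (Suc n)
  define i where "i = g - Suc n"
  then have i: "g - n = Suc i" "g - Suc n = i" using Suc.prems by auto
  have nonneg: "\<And>p. 0 \<le> Poly_Mapping.lookup D p" using assms(1) by (simp add: effective_def)
  have le: "pairing (beyond_vertex (Suc i)) D \<le> pairing (beyond_vertex i) D"
    by (intro pairing_mono nonneg beyond_vertex_Suc_le)
  have IH: "stay (special D) g n \<le> pairing (beyond_vertex (Suc i)) D"
    using Suc by (simp add: i)
  show ?case
  proof (cases "stay (special D) g n < pairing (beyond_vertex i) D")
    case False
    with IH le have eq: "pairing (beyond_vertex i) D \<le> pairing (beyond_vertex (Suc i)) D"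
      "stay (special D) g n = pairing (beyond_vertex (Suc i)) D" by linarith+
    have "pairing (loop_pos m (Suc i)) D =
        pairing (\<lambda>p. m (Suc i) * of_int (beyond_vertex (Suc i) p)) D"
      using pairing_eq_imp_eq[OF nonneg beyond_vertex_Suc_le eq(1)]
      by (intro pairing_cong loop_pos_eq_beyond_vertex) auto
    then have "special D (Suc i) (stay (special D) g n)"
      by (simp add: special_def pairing_mult_of_int eq)
    with IH le show ?thesis by (simp add: i)
  qed (simp add: i of_bool_def)
qed

lemma from_vertex_le_chips:
  assumes eff: "effective F"
    and e: "\<And>t. t \<le> g \<Longrightarrow> int (e t) \<le> Poly_Mapping.lookup F (Vertex t)"
    and equiv: "\<And>i. i \<in> {1..g} \<Longrightarrow>
      [pairing (loop_pos m i) D = pairing (loop_pos m i) F] (rmod (l i + m i))"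
    and "i \<le> g"
  shows "pairing (from_vertex i) F - int (e i) \<le> chips (special D) (deg F) e i"
  using assms(4)
proof (induction i)
  case 0
  have "from_vertex 0 p \<le> 1" for p by (cases "(0 :: nat, p)" rule: from_vertex.cases) auto
  then have "pairing (from_vertex 0) F \<le> deg F"
    using eff unfolding deg_conv_pairing by (intro pairing_mono) (auto simp: effective_def)
  then show ?case by simp
next
  case (Suc i)
  let ?K = "chips (special D) (deg F) e i" and ?C = "pairing (from_vertex (Suc i)) F"
  let ?h = "\<lambda>p. from_vertex (Suc i) p + of_bool (p = Vertex i)"
  have nonneg: "\<And>p. 0 \<le> Poly_Mapping.lookup F p" using eff by (simp add: effective_def)
  have h: "pairing ?h F = ?C + Poly_Mapping.lookup F (Vertex i)"
    by (rule pairing_add_indicator)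
  have le: "pairing ?h F \<le> pairing (from_vertex i) F"
    by (intro pairing_mono nonneg from_vertex_Suc_le)
  have IH: "pairing (from_vertex i) F - int (e i) \<le> ?K" using Suc by simp
  have ei: "int (e i) \<le> Poly_Mapping.lookup F (Vertex i)" using e Suc.prems by simp
  have "?C \<le> pass (special D) (Suc i) ?K"
  proof (cases "?C < ?K")
    case False
    with IH h le ei have eq: "pairing (from_vertex i) F \<le> pairing ?h F" "?K = ?C" by linarith+
    have "pairing (loop_pos m (Suc i)) F =
        pairing (\<lambda>p. m (Suc i) * of_int (from_vertex (Suc i) p)) F"
      using pairing_eq_imp_eq[OF nonneg from_vertex_Suc_le eq(1)]
      by (intro pairing_cong loop_pos_eq_from_vertex) auto
    then have "special D (Suc i) ?C"
      using equiv[of "Suc i"] Suc.prems by (simp add: special_def pairing_mult_of_int)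
    then show ?thesis by (simp add: pass_def eq(2))
  qed (simp add: pass_def of_bool_def)
  then show ?case by simp
qed

lemma special_unique:
  assumes gen: "generic_lengths g l m" and i: "i \<in> {1..g}"
    and d: "d \<le> 2 * int g - 2" and "special D i a" "special D i b"
    and bounds: "0 \<le> a" "a \<le> d" "0 \<le> b" "b \<le> d"
  shows "a = b"
proof -
  have False if "special D i a" "special D i b" "a < b" "0 \<le> a" "b \<le> d" for a b
  proof -
    have "[m i * of_int a = m i * of_int b] (rmod (l i + m i))"
      using that(1,2) unfolding special_def by (meson rcong_sym rcong_trans)
    then obtain n where "m i * of_int b = m i * of_int a + of_int n * (l i + m i)"
      unfolding rcong_altdef by blast
    then have n: "m i * of_int (b - a - n) = of_int n * l i" by (simp add: algebra_simps)
    have pos: "0 < l i" "0 < m i" using top_pos bottom_pos i by auto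
    have "0 < n"
    proof (rule ccontr)
      assume "\<not> 0 < n"
      then have "of_int n * l i \<le> 0" "0 < m i * of_int (b - a - n)"
        using pos that(3) by (auto simp: mult_le_0_iff)
      with n show False by simp
    qed
    moreover from this have "0 < m i * of_int (b - a - n)" unfolding n using pos by simp
    then have "0 < b - a - n" using pos by (simp add: zero_less_mult_iff)
    moreover have "l i / m i = of_int (b - a - n) / of_int n"
      using n pos \<open>0 < n\<close> by (simp add: field_simps)
    moreover have "(b - a - n) + n \<le> 2 * int g - 2" using that d by simp
    ultimately show False using gen i unfolding generic_lengths_def by blast
  qed
  from this[of a b] this[of b a] assms show ?thesis by (metis linorder_cases)
qed

lemma rank_imp_dominating:
  assumes "D \<in> Div \<Gamma>" "int r \<le> divisor_rank \<Gamma> D" "E \<in> Div \<Gamma>" "effective E" "deg E = int r"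
  obtains F where "effective F" "effective (F - E)" "deg F = deg D"
    "\<And>i. i \<in> {1..g} \<Longrightarrow> [pairing (loop_pos m i) D = pairing (loop_pos m i) F] (rmod (l i + m i))"
proof -
  have "verts \<Gamma> \<noteq> {}" by (simp add: chain_of_loops_def)
  then obtain F \<psi> where F: "effective F" "effective (F - E)" "PL \<Gamma> \<psi>" "D - F = div_of \<Gamma> \<psi>"
    using divisor_rank_ge_imp assms by metis
  show thesis
  proof (rule that[OF F(1,2)])
    have "deg (D - F) = 0" using deg_div_of[OF F(3)] F(4) by simp
    then show "deg F = deg D" by (simp add: deg_conv_pairing pairing_diff)
  next
    fix i assume "i \<in> {1..g}"
    from loop_pos_div_of[OF F(3) this]
    have "[pairing (loop_pos m i) D - pairing (loop_pos m i) F = 0] (rmod (l i + m i))"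
      by (simp add: pairing_diff flip: F(4))
    then show "[pairing (loop_pos m i) D = pairing (loop_pos m i) F] (rmod (l i + m i))"
      using rcong_diff_right_cancel[of _ "pairing (loop_pos m i) F" "pairing (loop_pos m i) F"] by simp
  qed
qed

lemma chips_nonneg:
  assumes D: "D \<in> Div \<Gamma>" "int r \<le> divisor_rank \<Gamma> D" and e: "(\<Sum>t\<le>g. e t) = r"
  shows "0 \<le> chips (special D) (deg D) e g"
proof -
  define E :: "(nat, nat \<times> side) divisor" where
    "E = (\<Sum>t\<le>g. frag_cmul (int (e t)) (frag_of (Vertex t)))"
  have lookup: "Poly_Mapping.lookup E p = (\<Sum>t\<le>g. int (e t) * of_bool (p = Vertex t))" for p
    unfolding E_def lookup_sum by (intro sum.cong) auto
  have "p \<in> points \<Gamma>" if "p \<in> Poly_Mapping.keys E" for p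
  proof -
    from that have "(\<Sum>t\<le>g. int (e t) * of_bool (p = Vertex t)) \<noteq> 0"
      by (simp add: in_keys_iff lookup)
    then obtain t where "t \<le> g" "p = Vertex t" by (auto elim: sum.not_neutral_contains_not_neutral)
    then show ?thesis by (auto simp: points_def chain_of_loops_def)
  qed
  then have "E \<in> Div \<Gamma>" by auto
  moreover have "effective E" by (auto simp: effective_def lookup intro: sum_nonneg)
  moreover have "deg E = int r" by (simp add: E_def deg_conv_pairing pairing_sum flip: e)
  ultimately obtain F where F: "effective F" "effective (F - E)" "deg F = deg D"
    "\<And>i. i \<in> {1..g} \<Longrightarrow> [pairing (loop_pos m i) D = pairing (loop_pos m i) F] (rmod (l i + m i))"
    using rank_imp_dominating[OF D] by metis
  have eF: "int (e t) \<le> Poly_Mapping.lookup F (Vertex t)" if "t \<le> g" for t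
  proof -
    have "Poly_Mapping.lookup E (Vertex t) = (\<Sum>s\<le>g. if s = t then int (e t) else 0)"
      unfolding lookup by (intro sum.cong) auto
    then have "Poly_Mapping.lookup E (Vertex t) = int (e t)" using that by simp
    moreover have "0 \<le> Poly_Mapping.lookup (F - E) (Vertex t)"
      using F(2) unfolding effective_def by blast
    ultimately show ?thesis by (simp add: lookup_minus)
  qed
  have "of_bool (p = Vertex g) \<le> from_vertex g p" for p
    by (cases "(g, p)" rule: from_vertex.cases) auto
  then have "pairing (\<lambda>p. of_bool (p = Vertex g)) F \<le> pairing (from_vertex g) F"
    using F(1) by (intro pairing_mono) (auto simp: effective_def)
  then have "int (e g) \<le> pairing (from_vertex g) F"
    using eF[of g] by (simp add: pairing_indicator)
  moreover have "pairing (from_vertex g) F - int (e g) \<le> chips (special D) (deg D) e g"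
    using from_vertex_le_chips[OF F(1) eF F(4), of g] F(3) by simp
  ultimately show ?thesis by simp
qed

lemma rank_ge_genus:
  assumes D: "D \<in> Div \<Gamma>" "int r \<le> divisor_rank \<Gamma> D" and "g \<le> r"
  shows "int g \<le> deg D - int r"
proof -
  have "\<exists>t. 0 < t \<and> t < m i \<and>
      \<not> [pairing (loop_pos m i) D - t - of_nat (g - i) * m i = m i * of_nat (g - i)] (rmod (l i + m i))"
    (is "\<exists>t. 0 < t \<and> t < m i \<and> \<not> ?cong t") if "i \<in> {1..g}" for i
  proof (rule ccontr)
    have pos: "0 < m i" "0 < l i" using that top_pos bottom_pos by auto
    assume "\<nexists>t. 0 < t \<and> t < m i \<and> \<not> ?cong t"
    then have "?cong (m i / 2)" "?cong (m i / 3)" using pos by auto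
    then have "[m i / 2 = m i / 3] (rmod (l i + m i))"
      by (meson rcong_diff_left_cancel rcong_diff_right_cancel rcong_sym rcong_trans)
    then have "m i / 2 = m i / 3" by (rule rcong_imp_eq) (use pos in auto)
    with pos show False by simp
  qed
  then obtain t where t: "\<And>i. i \<in> {1..g} \<Longrightarrow> 0 < t i \<and> t i < m i"
    "\<And>i. i \<in> {1..g} \<Longrightarrow> \<not> [pairing (loop_pos m i) D - t i - of_nat (g - i) * m i =
        m i * of_nat (g - i)] (rmod (l i + m i))" by metis
  define E :: "(nat, nat \<times> side) divisor" where
    "E = (\<Sum>i\<in>{1..g}. frag_of (Interior (i, Bottom) (t i))) + frag_cmul (int (r - g)) (frag_of (Vertex 0))"
  have lookup: "Poly_Mapping.lookup E p = (\<Sum>i\<in>{1..g}. of_bool (p = Interior (i, Bottom) (t i))) +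
      int (r - g) * of_bool (p = Vertex 0)" for p
    unfolding E_def lookup_add lookup_sum by (intro arg_cong2[of _ _ _ _ "(+)"] sum.cong) auto
  have "p \<in> points \<Gamma>" if "p \<in> Poly_Mapping.keys E" for p
  proof (cases "p = Vertex 0")
    case False
    with that have "(\<Sum>i\<in>{1..g}. of_bool (p = Interior (i, Bottom) (t i)) :: int) \<noteq> 0"
      by (simp add: in_keys_iff lookup)
    then obtain i where "i \<in> {1..g}" "p = Interior (i, Bottom) (t i)"
      by (auto elim: sum.not_neutral_contains_not_neutral)
    then show ?thesis using t(1)[of i] by (auto simp: points_def chain_of_loops_def)
  qed (auto simp: points_def chain_of_loops_def)
  then have "E \<in> Div \<Gamma>" by auto
  moreover have "effective E" by (auto simp: effective_def lookup intro: sum_nonneg)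
  moreover have degE: "deg E = int r"
    using assms(3) by (simp add: E_def deg_conv_pairing pairing_add pairing_sum)
  ultimately obtain F where F: "effective F" "effective (F - E)" "deg F = deg D"
    "\<And>i. i \<in> {1..g} \<Longrightarrow> [pairing (loop_pos m i) D = pairing (loop_pos m i) F] (rmod (l i + m i))"
    using rank_imp_dominating[OF D] by metis
  have posE: "pairing (loop_pos m i) E = t i + of_nat (g - i) * m i" if i: "i \<in> {1..g}" for i
  proof -
    have "pairing (loop_pos m i) E = (\<Sum>j\<in>{1..g}. loop_pos m i (Interior (j, Bottom) (t j)))"
      using i by (simp add: E_def pairing_add pairing_sum)
    also have "\<dots> = (\<Sum>j\<in>{1..g}. (if j = i then t i else 0) + (if j \<in> {Suc i..g} then m i else 0))"
      by (intro sum.cong) auto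
    also have "\<dots> = t i + (\<Sum>j\<in>{1..g}. if j \<in> {Suc i..g} then m i else 0)"
      using i by (simp add: sum.distrib)
    also have "\<dots> = t i + (\<Sum>j\<in>{1..g} \<inter> {Suc i..g}. m i)"
      by (subst sum.inter_restrict) auto
    also have "{1..g} \<inter> {Suc i..g} = {Suc i..g}" by auto
    finally show ?thesis by simp
  qed
  have not_special: "\<not> special (F - E) i (int (g - i))" if i: "i \<in> {1..g}" for i
  proof
    assume "special (F - E) i (int (g - i))"
    then have F_cong: "[pairing (loop_pos m i) F - (t i + of_nat (g - i) * m i) = m i * of_nat (g - i)]
        (rmod (l i + m i))"
      by (simp add: special_def pairing_diff posE[OF i])
    have "[pairing (loop_pos m i) D - (t i + of_nat (g - i) * m i) =
        pairing (loop_pos m i) F - (t i + of_nat (g - i) * m i)] (rmod (l i + m i))"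
      using F(4)[OF i] by simp
    from rcong_trans[OF this F_cong] t(2)[OF i] show False unfolding diff_diff_eq by blast
  qed
  have stay: "stay (special (F - E)) g n = int n" if "n \<le> g" for n
    using that
  proof (induction n)
    case (Suc n)
    then show ?case using not_special[of "g - n"] by auto
  qed simp
  have "beyond_vertex 0 p \<le> 1" for p by (cases "(0 :: nat, p)" rule: beyond_vertex.cases) auto
  then have "pairing (beyond_vertex 0) (F - E) \<le> deg (F - E)"
    using F(2) unfolding deg_conv_pairing by (intro pairing_mono) (auto simp: effective_def)
  also have "\<dots> = deg D - int r"
    using F(3) degE by (simp add: deg_conv_pairing pairing_diff)
  finally show ?thesis using stay_le_beyond[OF F(2), of g] stay[of g] by simp
qed

lemma stay_le_deg_diff:
  assumes "effective D"
  shows "stay (special D) g g \<le> deg D - Poly_Mapping.lookup D (Vertex 0)"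
proof -
  have "beyond_vertex 0 p + of_bool (p = Vertex 0) \<le> 1" for p
    by (cases "(0 :: nat, p)" rule: beyond_vertex.cases) auto
  then have "pairing (\<lambda>p. beyond_vertex 0 p + of_bool (p = Vertex 0)) D \<le> deg D"
    using assms unfolding deg_conv_pairing by (intro pairing_mono) (auto simp: effective_def)
  moreover have "pairing (\<lambda>p. beyond_vertex 0 p + of_bool (p = Vertex 0)) D =
      pairing (beyond_vertex 0) D + Poly_Mapping.lookup D (Vertex 0)"
    by (rule pairing_add_indicator)
  ultimately show ?thesis using stay_le_beyond[OF assms, of g] by simp
qed

lemma brill_noether:
  assumes gen: "generic_lengths g l m"
    and D: "D \<in> Div \<Gamma>" "effective D" "int r \<le> divisor_rank \<Gamma> D"
    and rho: "\<rho> = int g - (int r + 1) * (int g - deg D + int r)"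
  shows "0 \<le> \<rho> \<and> Poly_Mapping.lookup D (Vertex 0) \<le> int r + \<rho>"
proof (cases "int g \<le> deg D - int r")
  case True
  define s where "s = deg D - int r - int g"
  have "0 \<le> s" using True by (simp add: s_def)
  then have "0 \<le> int r * s" by simp
  moreover have "\<rho> = int g + int r * s + s" by (simp add: rho s_def algebra_simps)
  moreover have "Poly_Mapping.lookup D (Vertex 0) \<le> deg D"
    using stay_le_deg_diff[OF D(2)] stay_nonneg[of "special D" g g] by simp
  ultimately show ?thesis using \<open>0 \<le> s\<close> s_def by linarith
next
  case False
  then have "r < g" using rank_ge_genus[OF D(1,3)] by linarith
  with False have d: "deg D \<le> 2 * int g - 2" by linarith
  interpret chip_game g r "deg D" "special D"
  proof
    show "a = b" if "i \<in> {1..g}" "special D i a" "special D i b" "0 \<le> a" "a \<le> deg D"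
      "0 \<le> b" "b \<le> deg D" for i a b
      using special_unique[OF gen _ d] that by blast
    show "0 \<le> chips (special D) (deg D) e g" if "(\<Sum>t\<le>g. e t) = r" for e
      using chips_nonneg[OF D(1,3) that] .
  qed
  show ?thesis
    using stay_lower stay_upper stay_le_deg_diff[OF D(2)] by (simp add: rho algebra_simps)
qed

end

theorem theorem1p1:
  fixes g r :: nat and d \<rho> :: int
    and l m :: "nat \<Rightarrow> real"
    and \<Gamma> :: "(nat, nat \<times> side) metric_graph"
  assumes rho: "\<rho> = int g - (int r + 1) * (int g - d + int r)"
    and top_pos: "\<And>i. i \<in> {1..g} \<Longrightarrow> 0 < l i"
    and bottom_pos: "\<And>i. i \<in> {1..g} \<Longrightarrow> 0 < m i"
    and generic: "generic_lengths g l m"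
    and chain: "\<Gamma> = chain_of_loops g l m"
  shows "(\<rho> < 0 \<longrightarrow>
            \<not> (\<exists>D\<in>Div \<Gamma>. effective D \<and> deg D = d \<and> divisor_rank \<Gamma> D \<ge> int r))
       \<and> (\<rho> \<ge> 0 \<longrightarrow>
            \<not> (\<exists>D\<in>Div \<Gamma>. effective D \<and> deg D = d \<and> divisor_rank \<Gamma> D \<ge> int r \<and>
                 effective (D - frag_cmul (int r + \<rho> + 1) (frag_of (Vertex 0)))))"
proof -
  interpret loop_chain g l m using top_pos bottom_pos by unfold_locales
  have bound: "0 \<le> \<rho>" "Poly_Mapping.lookup D (Vertex 0) < int r + \<rho> + 1"
    if "D \<in> Div \<Gamma>" "effective D \<and> deg D = d \<and> divisor_rank \<Gamma> D \<ge> int r" for D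
    using brill_noether[OF generic, of D r \<rho>] that rho chain by auto
  have "Poly_Mapping.lookup D (Vertex 0) \<ge> int r + \<rho> + 1"
    if "effective (D - frag_cmul (int r + \<rho> + 1) (frag_of (Vertex 0)))"
    for D :: "(nat, nat \<times> side) divisor"
    using that[unfolded effective_def, rule_format, of "Vertex 0"] by (simp add: lookup_minus)
  then show ?thesis using bound by (meson not_le)
qed

end
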